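(* Let $R$ be a unital non-associative ring and let $\sigma: R\to R$ be an additive map such that $\sigma(1)=1$. If $R$ is right Noetherian and right quasi-associative, and $\sigma$ is surjective, then the non-associative skew power series ring $R[[X;\sigma]]$ is right Noetherian.
   Context: A non-associative ring is an additive abelian group with a multiplication that is left and right distributive over addition and not necessarily associative; it is unital if it has a two-sided multiplicative identity $1$. A right ideal of a non-associative ring $R$ is an additive subgroup $I$ with $ir\in I$ for all $i\in I$, $r\in R$. $R$ is right Noetherian if it satisfies the ascending chain condition on right ideals (equivalently, every right ideal is finitely generated as a right ideal). $R$ is right quasi-associative if for all $r,b,c\in R$ there exists $s\in R$ such that $(rb)c=rs$. For a unital non-associative ring $R$ and an additive map $\sigma:R\to R$ with $\sigma(1)=1$, the ring $R[[X;\sigma]]$ is the set of formal power series $\sum_{i=0}^\infty r_iX^i$ with $r_i\in R$, with coefficientwise addition and multiplication induced by $(rX^m)(sX^n)=(r\sigma^m(s))X^{m+n}$ for $m,n\ge 0$, i.e. $\left(\sum_i r_iX^i\right)\left(\sum_j s_jX^j\right)=\sum_{k=0}^\infty\left(\sum_{i=0}^k r_i\sigma^i(s_{k-i})\right)X^k$. It is again a (generally not associative) unital non-associative ring. *)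

theory Defs
  imports "HOL-Algebra.AbelCoset"
begin

locale nonassoc_ring = abelian_group R for R (structure) +
  assumes mult_closed: "\<lbrakk>x \<in> carrier R; y \<in> carrier R\<rbrakk> \<Longrightarrow> x \<otimes> y \<in> carrier R"
    and distrib_right:
      "\<lbrakk>x \<in> carrier R; y \<in> carrier R; z \<in> carrier R\<rbrakk> \<Longrightarrow> (x \<oplus> y) \<otimes> z = x \<otimes> z \<oplus> y \<otimes> z"
    and distrib_left:
      "\<lbrakk>x \<in> carrier R; y \<in> carrier R; z \<in> carrier R\<rbrakk> \<Longrightarrow> z \<otimes> (x \<oplus> y) = z \<otimes> x \<oplus> z \<otimes> y"

locale unital_nonassoc_ring = nonassoc_ring R for R (structure) +
  assumes unit_closed: "\<one> \<in> carrier R"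
    and unit_left: "x \<in> carrier R \<Longrightarrow> \<one> \<otimes> x = x"
    and unit_right: "x \<in> carrier R \<Longrightarrow> x \<otimes> \<one> = x"

locale right_ideal = additive_subgroup I R for I and R (structure) +
  assumes right_mult_closed: "\<lbrakk>i \<in> I; r \<in> carrier R\<rbrakk> \<Longrightarrow> i \<otimes> r \<in> I"

locale right_noetherian = nonassoc_ring R for R (structure) +
  assumes right_acc:
    "\<And>I :: nat \<Rightarrow> 'a set. \<lbrakk>\<And>n. right_ideal (I n) R; \<And>n. I n \<subseteq> I (Suc n)\<rbrakk>
      \<Longrightarrow> \<exists>N. \<forall>n\<ge>N. I n = I N"

definition right_quasi_associative :: "('a, 'm) ring_scheme \<Rightarrow> bool"
  where "right_quasi_associative R \<longleftrightarrow>
    (\<forall>r\<in>carrier R. \<forall>b\<in>carrier R. \<forall>c\<in>carrier R. \<exists>s\<in>carrier R.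
      (r \<otimes>\<^bsub>R\<^esub> b) \<otimes>\<^bsub>R\<^esub> c = r \<otimes>\<^bsub>R\<^esub> s)"

text \<open>A power series is its coefficient sequence, coefficients being written to the left of the
  powers of the indeterminate.\<close>

definition skew_power_series ::
  "('a, 'm) ring_scheme \<Rightarrow> ('a \<Rightarrow> 'a) \<Rightarrow> (nat \<Rightarrow> 'a) ring"
  where "skew_power_series R \<sigma> =
    \<lparr>carrier = UNIV \<rightarrow> carrier R,
     mult = (\<lambda>f g k. \<Oplus>\<^bsub>R\<^esub>i\<in>{..k}. f i \<otimes>\<^bsub>R\<^esub> (\<sigma> ^^ i) (g (k - i))),
     one = (\<lambda>k. if k = 0 then \<one>\<^bsub>R\<^esub> else \<zero>\<^bsub>R\<^esub>),
     zero = (\<lambda>k. \<zero>\<^bsub>R\<^esub>),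
     add = (\<lambda>f g k. f k \<oplus>\<^bsub>R\<^esub> g k)\<rparr>"

context nonassoc_ring
begin

lemma zero_mult:
  assumes "x \<in> carrier R" shows "\<zero> \<otimes> x = \<zero>"
proof -
  have "\<zero> \<otimes> x \<oplus> \<zero> \<otimes> x = \<zero> \<otimes> x \<oplus> \<zero>"
    using distrib_right[of \<zero> \<zero> x] assms by (simp add: mult_closed)
  then show ?thesis using assms by (simp add: mult_closed del: r_zero)
qed

lemma mult_zero:
  assumes "x \<in> carrier R" shows "x \<otimes> \<zero> = \<zero>"
proof -
  have "x \<otimes> \<zero> \<oplus> x \<otimes> \<zero> = x \<otimes> \<zero> \<oplus> \<zero>"
    using distrib_left[of \<zero> \<zero> x] assms by (simp add: mult_closed)
  then show ?thesis using assms by (simp add: mult_closed del: r_zero)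
qed

lemma additive_zero:
  assumes "\<sigma> \<in> hom (add_monoid R) (add_monoid R)"
  shows "\<sigma> \<zero> = \<zero>"
  using hom_one[OF assms] a_group by simp

lemma additive_funpow:
  assumes "\<sigma> \<in> hom (add_monoid R) (add_monoid R)"
  shows "\<sigma> ^^ n \<in> hom (add_monoid R) (add_monoid R)"
  using assms by (induction n) (auto simp: hom_def Pi_iff)

end

lemma (in unital_nonassoc_ring) skew_power_series_unital_nonassoc_ring:
  assumes hom: "\<sigma> \<in> hom (add_monoid R) (add_monoid R)" and unit: "\<sigma> \<one> = \<one>"
  shows "unital_nonassoc_ring (skew_power_series R \<sigma>)"
proof -
  let ?P = "skew_power_series R \<sigma>"
  note pow = additive_funpow[OF hom]
  have cl: "(\<sigma> ^^ n) x \<in> carrier R" if "x \<in> carrier R" for n x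
    using pow[of n] that by (auto simp: hom_def)
  have ad: "(\<sigma> ^^ n) (x \<oplus> y) = (\<sigma> ^^ n) x \<oplus> (\<sigma> ^^ n) y"
    if "x \<in> carrier R" "y \<in> carrier R" for n x y
    using pow[of n] that by (auto simp: hom_def)
  have z: "(\<sigma> ^^ n) \<zero> = \<zero>" for n by (rule additive_zero[OF pow])
  have u: "(\<sigma> ^^ n) \<one> = \<one>" for n by (induction n) (auto simp: unit)
  have ag: "abelian_group ?P"
  proof (rule abelian_groupI)
    fix f assume "f \<in> carrier ?P"
    then show "\<exists>g\<in>carrier ?P. g \<oplus>\<^bsub>?P\<^esub> f = \<zero>\<^bsub>?P\<^esub>"
      by (intro bexI[of _ "\<lambda>k. \<ominus> f k"])
        (auto simp: skew_power_series_def Pi_iff l_neg)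
  qed (auto simp: skew_power_series_def Pi_iff a_ac)
  show ?thesis
  proof (intro unital_nonassoc_ring.intro nonassoc_ring.intro ag
      nonassoc_ring_axioms.intro unital_nonassoc_ring_axioms.intro)
    fix f g assume fg: "f \<in> carrier ?P" "g \<in> carrier ?P"
    show "f \<otimes>\<^bsub>?P\<^esub> g \<in> carrier ?P"
      using fg by (auto simp: skew_power_series_def Pi_iff intro!: finsum_closed mult_closed cl)
    fix h assume h: "h \<in> carrier ?P"
    show "(f \<oplus>\<^bsub>?P\<^esub> g) \<otimes>\<^bsub>?P\<^esub> h = f \<otimes>\<^bsub>?P\<^esub> h \<oplus>\<^bsub>?P\<^esub> g \<otimes>\<^bsub>?P\<^esub> h"
      using fg h by (auto simp: skew_power_series_def Pi_iff fun_eq_iff distrib_right cl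
          mult_closed finsum_addf)
    show "h \<otimes>\<^bsub>?P\<^esub> (f \<oplus>\<^bsub>?P\<^esub> g) = h \<otimes>\<^bsub>?P\<^esub> f \<oplus>\<^bsub>?P\<^esub> h \<otimes>\<^bsub>?P\<^esub> g"
      using fg h by (auto simp: skew_power_series_def Pi_iff fun_eq_iff distrib_left cl ad
          mult_closed finsum_addf)
  next
    show "\<one>\<^bsub>?P\<^esub> \<in> carrier ?P"
      by (auto simp: skew_power_series_def unit_closed)
  next
    fix f assume f: "f \<in> carrier ?P"
    have "(\<Oplus>i\<in>{..k}. (if i = 0 then \<one> else \<zero>) \<otimes> (\<sigma> ^^ i) (f (k - i))) = f k" for k
    proof -
      have "(\<Oplus>i\<in>{..k}. (if i = 0 then \<one> else \<zero>) \<otimes> (\<sigma> ^^ i) (f (k - i)))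
          = (\<Oplus>i\<in>{..k}. if 0 = i then f (k - i) else \<zero>)"
        using f by (intro finsum_cong')
          (auto simp: skew_power_series_def Pi_iff unit_left zero_mult cl)
      then show ?thesis
        using f finsum_singleton[of 0 "{..k}" "\<lambda>i. f (k - i)"]
        by (simp add: skew_power_series_def Pi_iff)
    qed
    then show "\<one>\<^bsub>?P\<^esub> \<otimes>\<^bsub>?P\<^esub> f = f" by (simp add: skew_power_series_def)
    have "(\<Oplus>i\<in>{..k}. f i \<otimes> (\<sigma> ^^ i) (if k - i = 0 then \<one> else \<zero>)) = f k" for k
    proof -
      have "(\<Oplus>i\<in>{..k}. f i \<otimes> (\<sigma> ^^ i) (if k - i = 0 then \<one> else \<zero>))
          = (\<Oplus>i\<in>{..k}. if k = i then f i else \<zero>)"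
        using f by (intro finsum_cong')
          (auto simp: skew_power_series_def Pi_iff unit_right mult_zero u z)
      then show ?thesis
        using f finsum_singleton[of k "{..k}" f]
        by (simp add: skew_power_series_def Pi_iff)
    qed
    then show "f \<otimes>\<^bsub>?P\<^esub> \<one>\<^bsub>?P\<^esub> = f" by (simp add: skew_power_series_def)
  qed
qed

end

theory Submission
  imports Defs
begin

text \<open>The coefficients of \<open>X\<^sup>n\<close> of the series of order at least \<open>n\<close> in a right ideal \<open>J\<close> form
  a right ideal of \<open>R\<close> (surjectivity of \<open>\<sigma>\<close>), increasing in \<open>n\<close> (multiply by \<open>X\<close>) and in \<open>J\<close>.
  Along an ascending chain \<open>J\<^sub>m\<close> the diagonal of this double family is constant from some \<open>N\<close> on,
  with value a finite sum of sets \<open>a R\<close>: by quasi-associativity each \<open>a R\<close> is already a right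
  ideal. Lifting the \<open>a\<close> to series in \<open>J\<^sub>N\<close>, every series of order at least \<open>N\<close> in any \<open>J\<^sub>m\<close> is
  a right combination of these lifts; the finitely many lower degrees are handled one by one.\<close>

section \<open>Right ideals of a non-associative ring\<close>

lemma right_idealI:
  assumes "nonassoc_ring R" "I \<subseteq> carrier R" "\<zero>\<^bsub>R\<^esub> \<in> I"
    and "\<And>x y. x \<in> I \<Longrightarrow> y \<in> I \<Longrightarrow> x \<oplus>\<^bsub>R\<^esub> y \<in> I"
    and "\<And>x. x \<in> I \<Longrightarrow> \<ominus>\<^bsub>R\<^esub> x \<in> I"
    and "\<And>x r. x \<in> I \<Longrightarrow> r \<in> carrier R \<Longrightarrow> x \<otimes>\<^bsub>R\<^esub> r \<in> I"
  shows "right_ideal I R"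
proof -
  interpret nonassoc_ring R by fact
  have "subgroup I (add_monoid R)"
    by (rule subgroup.intro) (use assms in \<open>auto simp: a_inv_def\<close>)
  then show ?thesis
    using assms by (intro right_ideal.intro additive_subgroup.intro right_ideal_axioms.intro)
qed

lemma (in right_ideal) finsum_mem:
  assumes "abelian_group R" "finite A" "\<And>a. a \<in> A \<Longrightarrow> g a \<in> I"
  shows "(\<Oplus>a\<in>A. g a) \<in> I"
proof -
  interpret abelian_group R by fact
  from assms(2,3) show ?thesis
    by (induction A rule: finite_induct) (auto simp: Pi_iff a_subset[THEN subsetD])
qed

lemma (in right_ideal) a_inv_mem:
  assumes "abelian_group R" "x \<in> I"
  shows "\<ominus> x \<in> I"
  using subgroup.m_inv_closed[OF a_subgroup assms(2)] by (simp add: a_inv_def)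

section \<open>Finite right spans and finite generation of right ideals\<close>

context nonassoc_ring
begin

text \<open>For finite \<open>A\<close> this is the sum of the sets \<open>a R\<close>, with a
  single right factor per generator. In general it is only an additive subgroup, possibly smaller
  than the right ideal generated by \<open>A\<close>.\<close>

definition right_span :: "'a set \<Rightarrow> 'a set"
  where "right_span A = (\<lambda>c. \<Oplus>a\<in>A. a \<otimes> c a) ` (A \<rightarrow> carrier R)"

lemma a_inv_mult_right:
  assumes "x \<in> carrier R" "y \<in> carrier R"
  shows "\<ominus> (x \<otimes> y) = x \<otimes> (\<ominus> y)"
proof (rule minus_equality)
  show "x \<otimes> (\<ominus> y) \<oplus> x \<otimes> y = \<zero>"
    using assms distrib_left[of "\<ominus> y" y x] by (simp add: l_neg mult_zero)
qed (use assms in \<open>auto simp: mult_closed\<close>)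

lemma finsum_mult_right:
  assumes "finite A" "\<And>a. a \<in> A \<Longrightarrow> g a \<in> carrier R" "r \<in> carrier R"
  shows "(\<Oplus>a\<in>A. g a) \<otimes> r = (\<Oplus>a\<in>A. g a \<otimes> r)"
  using assms
proof (induction A rule: finite_induct)
  case (insert a A)
  then show ?case
    by (simp add: Pi_iff distrib_right mult_closed)
qed (simp add: zero_mult)

text \<open>Quasi-associativity turns each \<open>(a \<otimes> c a) \<otimes> r\<close> into
  \<open>a \<otimes> s a\<close> with the same left factor, so right multiplication only changes the
  right factors.\<close>

lemma right_ideal_right_span:
  assumes "right_quasi_associative R" "finite A" "A \<subseteq> carrier R"
  shows "right_ideal (right_span A) R"
proof (rule right_idealI)
  have [simp]: "a \<in> carrier R" if "a \<in> A" for a using that assms by auto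
  show "nonassoc_ring R" by unfold_locales
  show "right_span A \<subseteq> carrier R"
    by (auto simp: right_span_def Pi_iff mult_closed intro!: finsum_closed)
  have "(\<Oplus>a\<in>A. a \<otimes> \<zero>) = \<zero>"
    using finsum_cong'[of A A "\<lambda>_. \<zero>" "\<lambda>a. a \<otimes> \<zero>"] by (simp add: mult_zero)
  then show "\<zero> \<in> right_span A"
    unfolding right_span_def by (intro image_eqI[of _ _ "\<lambda>_. \<zero>"]) auto
  fix x assume "x \<in> right_span A"
  then obtain c where c: "\<And>a. a \<in> A \<Longrightarrow> c a \<in> carrier R" and x: "x = (\<Oplus>a\<in>A. a \<otimes> c a)"
    by (auto simp: right_span_def Pi_iff)
  {
    fix y assume "y \<in> right_span A"
    then obtain d where d: "\<And>a. a \<in> A \<Longrightarrow> d a \<in> carrier R" and y: "y = (\<Oplus>a\<in>A. a \<otimes> d a)"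
      by (auto simp: right_span_def Pi_iff)
    have "x \<oplus> y = (\<Oplus>a\<in>A. a \<otimes> c a \<oplus> a \<otimes> d a)"
      unfolding x y using c d by (subst finsum_addf) (auto simp: mult_closed)
    also have "\<dots> = (\<Oplus>a\<in>A. a \<otimes> (c a \<oplus> d a))"
      using c d by (intro finsum_cong') (auto simp: mult_closed distrib_left)
    finally show "x \<oplus> y \<in> right_span A"
      unfolding right_span_def using c d
      by (intro image_eqI[of _ _ "\<lambda>a. c a \<oplus> d a"]) auto
  }
  show "x \<otimes> r \<in> right_span A" if r: "r \<in> carrier R" for r
  proof -
    have "\<forall>a\<in>A. \<exists>s\<in>carrier R. (a \<otimes> c a) \<otimes> r = a \<otimes> s"
      using assms(1) c r unfolding right_quasi_associative_def by simp
    then obtain s where s: "\<And>a. a \<in> A \<Longrightarrow> s a \<in> carrier R"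
      and eq: "\<And>a. a \<in> A \<Longrightarrow> (a \<otimes> c a) \<otimes> r = a \<otimes> s a"
      by metis
    have "x \<otimes> r = (\<Oplus>a\<in>A. (a \<otimes> c a) \<otimes> r)"
      unfolding x using c r assms(2) by (intro finsum_mult_right) (auto simp: mult_closed)
    also have "\<dots> = (\<Oplus>a\<in>A. a \<otimes> s a)"
      using s eq by (intro finsum_cong') (auto simp: mult_closed)
    finally show ?thesis
      unfolding right_span_def using s by (intro image_eqI[of _ _ s]) auto
  qed
  have "x \<oplus> (\<Oplus>a\<in>A. a \<otimes> (\<ominus> c a)) = (\<Oplus>a\<in>A. a \<otimes> c a \<oplus> a \<otimes> (\<ominus> c a))"
    unfolding x using c by (subst finsum_addf) (auto simp: mult_closed)
  also have "\<dots> = (\<Oplus>a\<in>A. \<zero>)"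
    using c by (intro finsum_cong') (auto simp: mult_closed a_inv_mult_right[symmetric] r_neg)
  finally have "x \<oplus> (\<Oplus>a\<in>A. a \<otimes> (\<ominus> c a)) = \<zero>" by simp
  then have "\<ominus> x = (\<Oplus>a\<in>A. a \<otimes> (\<ominus> c a))"
    using c unfolding x
    by (intro minus_equality) (auto simp: mult_closed a_comm intro!: finsum_closed)
  then show "\<ominus> x \<in> right_span A"
    unfolding right_span_def using c by (intro image_eqI[of _ _ "\<lambda>a. \<ominus> c a"]) auto
qed

text \<open>Giving the new generator the right factor zero leaves the sum unchanged.\<close>

lemma right_span_mono:
  assumes "finite A" "A \<subseteq> carrier R" "x \<in> carrier R"
  shows "right_span A \<subseteq> right_span (insert x A)"
proof (cases "x \<in> A")
  case False
  show ?thesis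
  proof
    fix y assume "y \<in> right_span A"
    then obtain c where c: "\<And>a. a \<in> A \<Longrightarrow> c a \<in> carrier R" and y: "y = (\<Oplus>a\<in>A. a \<otimes> c a)"
      by (auto simp: right_span_def Pi_iff)
    define d where "d = c(x := \<zero>)"
    have d: "d a \<in> carrier R" if "a \<in> insert x A" for a
      using that c by (auto simp: d_def)
    have "y = (\<Oplus>a\<in>A. a \<otimes> d a)"
      unfolding y using c False assms
      by (intro finsum_cong') (auto simp: d_def mult_closed subset_iff)
    moreover have "x \<otimes> d x = \<zero>" by (simp add: d_def mult_zero assms)
    moreover have prod: "(\<lambda>a. a \<otimes> d a) \<in> A \<rightarrow> carrier R"
      using d assms by (auto simp: mult_closed subset_iff)
    ultimately have "y = (\<Oplus>a\<in>insert x A. a \<otimes> d a)"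
      using assms False finsum_closed[OF prod] by (subst finsum_insert) auto
    then show "y \<in> right_span (insert x A)"
      unfolding right_span_def using d by (intro image_eqI[of _ _ d]) auto
  qed
qed (simp add: insert_absorb)

end

context unital_nonassoc_ring
begin

lemma mem_right_span:
  assumes "finite A" "A \<subseteq> carrier R" "x \<in> A"
  shows "x \<in> right_span A"
proof -
  have "(\<Oplus>a\<in>A. a \<otimes> (if a = x then \<one> else \<zero>)) = (\<Oplus>a\<in>A. if x = a then a else \<zero>)"
    using assms by (intro finsum_cong') (auto simp: unit_right mult_zero subset_iff)
  also have "\<dots> = x"
    using assms finsum_singleton[of x A "\<lambda>a. a"] by auto
  finally show ?thesis
    unfolding right_span_def
    by (intro image_eqI[of _ _ "\<lambda>a. if a = x then \<one> else \<zero>"]) (auto simp: unit_closed)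
qed

text \<open>If no finite subset sufficed, an element of \<open>L\<close> outside the current span
  could be adjoined forever, and the spans would form a strictly increasing chain of right
  ideals.\<close>

lemma noetherian_right_ideal_eq_right_span:
  assumes "right_noetherian R" "right_quasi_associative R" "right_ideal L R"
  shows "\<exists>A. finite A \<and> A \<subseteq> L \<and> L \<subseteq> right_span A"
proof (rule ccontr)
  assume "\<not> ?thesis"
  then have no: "\<exists>x\<in>L. x \<notin> right_span A" if "finite A" "A \<subseteq> L" for A
    using that by blast
  interpret L: right_ideal L R by fact
  have LR: "L \<subseteq> carrier R" by (rule L.a_subset)
  have "\<exists>A. \<forall>n. (finite (A n) \<and> A n \<subseteq> L)
      \<and> (\<exists>x. A (Suc n) = insert x (A n) \<and> x \<in> L \<and> x \<notin> right_span (A n))"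
  proof (rule dependent_nat_choice)
    fix A and n :: nat assume A: "finite A \<and> A \<subseteq> L"
    then obtain x where "x \<in> L" "x \<notin> right_span A" using no by blast
    then show "\<exists>B. (finite B \<and> B \<subseteq> L) \<and> (\<exists>x. B = insert x A \<and> x \<in> L \<and> x \<notin> right_span A)"
      using A by (intro exI[of _ "insert x A"]) auto
  qed (intro exI[of _ "{}"], simp)
  then obtain A where fin: "\<And>n. finite (A n)" and sub: "\<And>n. A n \<subseteq> L"
    and step: "\<And>n. \<exists>x. A (Suc n) = insert x (A n) \<and> x \<in> L \<and> x \<notin> right_span (A n)"
    by blast
  have subR: "A n \<subseteq> carrier R" for n using sub LR by blast
  have "\<exists>N. \<forall>n\<ge>N. right_span (A n) = right_span (A N)"
  proof (rule right_noetherian.right_acc[OF assms(1)])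
    show "right_ideal (right_span (A n)) R" for n
      by (rule right_ideal_right_span[OF assms(2) fin subR])
    show "right_span (A n) \<subseteq> right_span (A (Suc n))" for n
    proof -
      obtain x where "A (Suc n) = insert x (A n)" "x \<in> L" using step[of n] by blast
      then show ?thesis using right_span_mono[OF fin subR, of x n] LR by auto
    qed
  qed
  then obtain N where "right_span (A (Suc N)) = right_span (A N)" using le_SucI by blast
  \<comment> \<open>The element adjoined in passing from \<open>A N\<close> to
    \<open>A (Suc N)\<close> lies in the larger span but not in the smaller one.\<close>
  moreover obtain x where "x \<in> A (Suc N)" "x \<notin> right_span (A N)" using step[of N] by blast
  ultimately show False
    using mem_right_span[OF fin subR] by blast
qed

end

section \<open>Coefficients and leading coefficients of skew power series\<close>

locale skew_series_ring = unital_nonassoc_ring R for R (structure) +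
  fixes \<sigma> :: "'a \<Rightarrow> 'a"
  assumes hom: "\<sigma> \<in> hom (add_monoid R) (add_monoid R)"
    and sigma_one: "\<sigma> \<one> = \<one>"
begin

abbreviation "P \<equiv> skew_power_series R \<sigma>"

sublocale P: unital_nonassoc_ring P
  by (rule skew_power_series_unital_nonassoc_ring[OF hom sigma_one])

lemma mem_series_iff: "f \<in> carrier P \<longleftrightarrow> (\<forall>k. f k \<in> carrier R)"
  by (auto simp: skew_power_series_def)

lemma coeff_closed [simp]: "f \<in> carrier P \<Longrightarrow> f k \<in> carrier R"
  by (simp add: mem_series_iff)

lemma coeff_add: "(f \<oplus>\<^bsub>P\<^esub> g) k = f k \<oplus> g k"
  by (simp add: skew_power_series_def)

lemma coeff_zero: "\<zero>\<^bsub>P\<^esub> k = \<zero>"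
  by (simp add: skew_power_series_def)

lemma coeff_mult: "(f \<otimes>\<^bsub>P\<^esub> g) k = (\<Oplus>i\<in>{..k}. f i \<otimes> (\<sigma> ^^ i) (g (k - i)))"
  by (simp add: skew_power_series_def)

lemma coeff_a_inv:
  assumes "f \<in> carrier P"
  shows "(\<ominus>\<^bsub>P\<^esub> f) k = \<ominus> f k"
proof -
  have "(\<ominus>\<^bsub>P\<^esub> f) k \<oplus> f k = \<zero>"
    using P.l_neg[OF assms] by (metis coeff_add coeff_zero)
  then show ?thesis
    using assms by (metis P.a_inv_closed coeff_closed minus_equality)
qed

lemma coeff_finsum:
  assumes "finite A" "\<And>a. a \<in> A \<Longrightarrow> g a \<in> carrier P"
  shows "(\<Oplus>\<^bsub>P\<^esub>a\<in>A. g a) k = (\<Oplus>a\<in>A. g a k)"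
  using assms
  by (induction A rule: finite_induct) (simp_all add: coeff_zero coeff_add Pi_iff)

lemma sigma_pow_closed: "x \<in> carrier R \<Longrightarrow> (\<sigma> ^^ n) x \<in> carrier R"
  using additive_funpow[OF hom, of n] by (auto simp: hom_def)

lemma sigma_pow_zero: "(\<sigma> ^^ n) \<zero> = \<zero>"
  by (rule additive_zero[OF additive_funpow[OF hom]])

lemma sigma_pow_one: "(\<sigma> ^^ n) \<one> = \<one>"
  by (induction n) (auto simp: sigma_one)

definition monomial :: "'a \<Rightarrow> nat \<Rightarrow> nat \<Rightarrow> 'a"
  where "monomial r n = (\<lambda>k. if k = n then r else \<zero>)"

lemma monomial_closed: "r \<in> carrier R \<Longrightarrow> monomial r n \<in> carrier P"
  by (simp add: mem_series_iff monomial_def)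

text \<open>Only the term \<open>i = k\<close> survives. The twist on \<open>r\<close> depends on
  the degree \<open>k\<close> in the left factor, not on \<open>n\<close>; to obtain a prescribed
  product one therefore needs preimages under \<open>\<sigma> ^^ k\<close>.\<close>

lemma coeff_mult_monomial:
  assumes "f \<in> carrier P" "r \<in> carrier R"
  shows "(f \<otimes>\<^bsub>P\<^esub> monomial r n) (k + n) = f k \<otimes> (\<sigma> ^^ k) r"
proof -
  have "(f \<otimes>\<^bsub>P\<^esub> monomial r n) (k + n)
      = (\<Oplus>i\<in>{..k + n}. if k = i then f i \<otimes> (\<sigma> ^^ i) r else \<zero>)"
    unfolding coeff_mult using assms
    by (intro finsum_cong')
      (auto simp: monomial_def mult_closed sigma_pow_closed sigma_pow_zero mult_zero)
  also have "\<dots> = f k \<otimes> (\<sigma> ^^ k) r"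
    using assms by (subst finsum_singleton) (auto simp: mult_closed sigma_pow_closed)
  finally show ?thesis .
qed

text \<open>Terms with \<open>i < N\<close> vanish, and \<open>i \<ge> N\<close> forces
  \<open>k - i < n\<close>. So a left factor of order at least \<open>N\<close> delays the influence
  of the \<open>n\<close>-th coefficient of \<open>h\<close> to degree \<open>N + n\<close>.\<close>

lemma coeff_mult_cong:
  assumes "f \<in> carrier P" "h \<in> carrier P" "h' \<in> carrier P"
    and "\<And>i. i < N \<Longrightarrow> f i = \<zero>" "\<And>i. i < n \<Longrightarrow> h i = h' i" "k < N + n"
  shows "(f \<otimes>\<^bsub>P\<^esub> h) k = (f \<otimes>\<^bsub>P\<^esub> h') k"
  unfolding coeff_mult
proof (rule finsum_cong')
  fix i assume i: "i \<in> {..k}"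
  show "f i \<otimes> (\<sigma> ^^ i) (h (k - i)) = f i \<otimes> (\<sigma> ^^ i) (h' (k - i))"
  proof (cases "i < N")
    case True
    then show ?thesis using assms by (simp add: zero_mult sigma_pow_closed)
  next
    case False
    then have "k - i < n" using i assms(6) by auto
    then show ?thesis using assms by simp
  qed
qed (use assms in \<open>auto simp: mult_closed sigma_pow_closed\<close>)

text \<open>Order at least \<open>n\<close> is required rather than exactly \<open>n\<close>, so
  that zero is included and sums cause no cancellation problem.\<close>

definition leading :: "(nat \<Rightarrow> 'a) set \<Rightarrow> nat \<Rightarrow> 'a set"
  where "leading J n = {f n | f. f \<in> J \<and> (\<forall>i<n. f i = \<zero>)}"

lemma leadingI: "f \<in> J \<Longrightarrow> (\<And>i. i < n \<Longrightarrow> f i = \<zero>) \<Longrightarrow> f n \<in> leading J n"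
  by (auto simp: leading_def)

lemma leadingE:
  assumes "r \<in> leading J n"
  obtains f where "f \<in> J" "\<And>i. i < n \<Longrightarrow> f i = \<zero>" "f n = r"
  using assms by (auto simp: leading_def)

lemma leading_mono: "J \<subseteq> K \<Longrightarrow> leading J n \<subseteq> leading K n"
  by (auto simp: leading_def)

text \<open>Right multiplication by X, which is \<open>monomial \<one> 1\<close>, shifts the
  coefficients by one degree without altering them, because every power of \<open>\<sigma>\<close>
  fixes \<open>\<one>\<close>.\<close>

lemma leading_Suc:
  assumes "right_ideal J P"
  shows "leading J n \<subseteq> leading J (Suc n)"
proof
  interpret J: right_ideal J P by fact
  fix r assume "r \<in> leading J n"
  then obtain f where f: "f \<in> J" "\<And>i. i < n \<Longrightarrow> f i = \<zero>" "f n = r" by (rule leadingE) blast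
  let ?g = "f \<otimes>\<^bsub>P\<^esub> monomial \<one> 1"
  have fP: "f \<in> carrier P" using f(1) J.a_subset by blast
  have shift: "?g (Suc k) = f k" for k
    using coeff_mult_monomial[OF fP unit_closed, of 1 k] fP
    by (simp add: sigma_pow_one unit_right)
  have "?g 0 = \<zero>"
    using fP by (simp add: coeff_mult monomial_def mult_zero)
  then have "?g i = \<zero>" if "i < Suc n" for i
    using that f(2) shift by (cases i) auto
  moreover have "?g \<in> J"
    by (intro J.right_mult_closed f monomial_closed unit_closed)
  ultimately have "?g (Suc n) \<in> leading J (Suc n)" by (intro leadingI)
  then show "r \<in> leading J (Suc n)" by (simp only: shift f(3))
qed

end

section \<open>Right ideals of leading coefficients for surjective \<sigma>\<close>

locale surjective_skew_series_ring = skew_series_ring +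
  assumes sigma_surj: "\<sigma> ` carrier R = carrier R"
begin

lemma sigma_pow_surj: "(\<sigma> ^^ n) ` carrier R = carrier R"
  by (induction n) (auto simp: image_comp[symmetric] sigma_surj simp del: o_apply)

lemma sigma_pow_preimage:
  assumes "r \<in> carrier R"
  obtains t where "t \<in> carrier R" "(\<sigma> ^^ n) t = r"
proof -
  have "r \<in> (\<sigma> ^^ n) ` carrier R" using assms by (simp add: sigma_pow_surj)
  then show ?thesis using that by blast
qed

text \<open>A constant right factor \<open>t\<close> multiplies the coefficient of degree
  \<open>n\<close> by \<open>(\<sigma> ^^ n) t\<close>; choosing \<open>t\<close> as a preimage of
  \<open>r\<close> yields the product \<open>x \<otimes> r\<close>, and the lower coefficients
  remain zero.\<close>

lemma right_ideal_leading:
  assumes "right_ideal J P"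
  shows "right_ideal (leading J n) R"
proof (rule right_idealI)
  interpret J: right_ideal J P by fact
  have JP: "f \<in> carrier P" if "f \<in> J" for f using J.a_subset that by blast
  show "nonassoc_ring R" by unfold_locales
  show "leading J n \<subseteq> carrier R" using JP by (auto simp: leading_def)
  show "\<zero> \<in> leading J n"
    using leadingI[OF J.zero_closed, of n] by (simp add: coeff_zero)
  fix x assume "x \<in> leading J n"
  then obtain f where f: "f \<in> J" "\<And>i. i < n \<Longrightarrow> f i = \<zero>" "f n = x" by (rule leadingE) blast
  have fP: "f \<in> carrier P" using f(1) JP by blast
  show "x \<oplus> y \<in> leading J n" if y: "y \<in> leading J n" for y
  proof -
    obtain g where g: "g \<in> J" "\<And>i. i < n \<Longrightarrow> g i = \<zero>" "g n = y"
      using y by (rule leadingE) blast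
    then show ?thesis
      using leadingI[OF J.a_closed[OF f(1) g(1)], of n] f by (simp add: coeff_add)
  qed
  show "\<ominus> x \<in> leading J n"
    using leadingI[OF J.a_inv_mem[OF P.abelian_group_axioms f(1)], of n] f fP
    by (simp add: coeff_a_inv)
  show "x \<otimes> r \<in> leading J n" if r: "r \<in> carrier R" for r
  proof -
    obtain t where t: "t \<in> carrier R" "(\<sigma> ^^ n) t = r"
      by (rule sigma_pow_preimage[OF r])
    let ?g = "f \<otimes>\<^bsub>P\<^esub> monomial t 0"
    have "?g k = f k \<otimes> (\<sigma> ^^ k) t" for k
      using coeff_mult_monomial[OF fP t(1), of 0 k] by simp
    then show ?thesis
      using leadingI[of ?g J n] f t
      by (simp add: J.right_mult_closed monomial_closed zero_mult sigma_pow_closed)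
  qed
qed

section \<open>Series of high order as right combinations of the lifted generators\<close>

text \<open>Only the right factors are built by successive approximation: the generators stay fixed and
  finite in number, so the limit stays in the ideal although ideals need not be closed a priori.\<close>

lemma series_eq_finsum_mult:
  assumes J: "right_ideal J P" and A: "finite A"
    and F: "\<And>a. a \<in> A \<Longrightarrow> F a \<in> J" "\<And>a i. a \<in> A \<Longrightarrow> i < N \<Longrightarrow> F a i = \<zero>"
      "\<And>a. a \<in> A \<Longrightarrow> F a N = a"
    and lead: "\<And>n. n \<ge> N \<Longrightarrow> leading J n \<subseteq> right_span A"
    and f: "f \<in> J" "\<And>i. i < N \<Longrightarrow> f i = \<zero>"
  shows "\<exists>H. (\<forall>a\<in>A. H a \<in> carrier P) \<and> f = (\<Oplus>\<^bsub>P\<^esub>a\<in>A. F a \<otimes>\<^bsub>P\<^esub> H a)"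
proof -
  interpret J: right_ideal J P by fact
  have JP: "g \<in> carrier P" if "g \<in> J" for g using J.a_subset that by blast
  have FP: "F a \<in> carrier P" if "a \<in> A" for a using F(1) JP that by blast
  have AR: "a \<in> carrier R" if "a \<in> A" for a using FP[OF that] F(3)[OF that] by (metis coeff_closed)
  define S where "S H = (\<Oplus>\<^bsub>P\<^esub>a\<in>A. F a \<otimes>\<^bsub>P\<^esub> H a)" for H
  have coeff_S: "S H k = (\<Oplus>a\<in>A. (F a \<otimes>\<^bsub>P\<^esub> H a) k)" if "\<forall>a\<in>A. H a \<in> carrier P" for H k
    unfolding S_def using that A FP by (intro coeff_finsum) (auto simp: P.mult_closed)
  have S_J: "S H \<in> J" if "\<forall>a\<in>A. H a \<in> carrier P" for H
    unfolding S_def using that A F(1)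
    by (intro J.finsum_mem P.abelian_group_axioms) (auto intro: J.right_mult_closed)
  \<comment> \<open>Every \<open>F a\<close> has order at least \<open>N\<close>, so changing the
    right factors from degree \<open>n\<close> on affects the combination only from degree
    \<open>N + n\<close> on.\<close>
  have S_cong: "S H k = S H' k"
    if "\<forall>a\<in>A. H a \<in> carrier P" "\<forall>a\<in>A. H' a \<in> carrier P"
      "\<And>a i. a \<in> A \<Longrightarrow> i < n \<Longrightarrow> H a i = H' a i" "k < N + n" for H H' n k
    unfolding coeff_S[OF that(1)] coeff_S[OF that(2)]
  proof (rule finsum_cong')
    fix a assume a: "a \<in> A"
    show "(F a \<otimes>\<^bsub>P\<^esub> H a) k = (F a \<otimes>\<^bsub>P\<^esub> H' a) k"
      by (rule coeff_mult_cong[OF FP[OF a] _ _ F(2)[OF a] that(3)[OF a] that(4)])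
        (use that a in auto)
  qed (use that FP in \<open>auto simp: P.mult_closed\<close>)
  define good where "good n H \<longleftrightarrow> (\<forall>a\<in>A. H a \<in> carrier P) \<and> (\<forall>k<N + n. S H k = f k)" for n H
  \<comment> \<open>Stage \<open>n\<close> matches \<open>f\<close> below degree
    \<open>N + n\<close>; each stage keeps the right factors below degree \<open>n\<close>, so their
    coefficients converge.\<close>
  have "\<exists>H. \<forall>n. good n (H n) \<and> (\<forall>a\<in>A. \<forall>i<n. H n a i = H (Suc n) a i)"
  proof (rule dependent_nat_choice)
    have "S (\<lambda>_. \<zero>\<^bsub>P\<^esub>) k = f k" if "k < N" for k
    proof -
      have "S (\<lambda>_. \<zero>\<^bsub>P\<^esub>) k = (\<Oplus>a\<in>A. \<zero>)"
        unfolding coeff_S[OF ballI[OF P.zero_closed]]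
        using FP by (intro finsum_cong') (auto simp: P.mult_zero coeff_zero)
      then show ?thesis using f(2)[OF that] by simp
    qed
    then show "\<exists>H. good 0 H"
      by (intro exI[of _ "\<lambda>_. \<zero>\<^bsub>P\<^esub>"]) (simp add: good_def)
  next
    fix H n assume "good n H"
    then have HP: "\<forall>a\<in>A. H a \<in> carrier P" and Hf: "\<And>k. k < N + n \<Longrightarrow> S H k = f k"
      by (auto simp: good_def)
    \<comment> \<open>The remainder lies in \<open>J\<close> and has order at least
      \<open>N + n\<close>, so its coefficient there is a leading coefficient and can be written
      with the generators in \<open>A\<close>.\<close>
    define g where "g = f \<oplus>\<^bsub>P\<^esub> \<ominus>\<^bsub>P\<^esub> S H"
    have SP: "S H \<in> carrier P" and fP: "f \<in> carrier P" using S_J[OF HP] f(1) JP by auto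
    have g: "g k = f k \<oplus> \<ominus> S H k" for k
      unfolding g_def coeff_add coeff_a_inv[OF SP] ..
    have "g \<in> J"
      unfolding g_def
      by (intro J.a_closed f J.a_inv_mem P.abelian_group_axioms S_J HP)
    moreover have "g k = \<zero>" if "k < N + n" for k
      using that fP by (simp add: g Hf r_neg)
    ultimately have "g (N + n) \<in> right_span A"
      using lead[of "N + n"] by (auto dest: leadingI)
    then obtain c where c: "c \<in> A \<rightarrow> carrier R" "g (N + n) = (\<Oplus>a\<in>A. a \<otimes> c a)"
      by (auto simp: right_span_def)
    \<comment> \<open>The coefficient of \<open>F a\<close> at \<open>N\<close> is \<open>a\<close>,
      so multiplying by \<open>monomial (t a) n\<close> contributes
      \<open>a \<otimes> (\<sigma> ^^ N) (t a)\<close> at degree \<open>N + n\<close>. The power of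
      \<open>\<sigma>\<close> to invert is \<open>N\<close>, whatever \<open>n\<close> is.\<close>
    then have "\<forall>a\<in>A. \<exists>t\<in>carrier R. (\<sigma> ^^ N) t = c a"
      by (blast elim: sigma_pow_preimage[of _ N])
    then obtain t where t: "\<And>a. a \<in> A \<Longrightarrow> t a \<in> carrier R" "\<And>a. a \<in> A \<Longrightarrow> (\<sigma> ^^ N) (t a) = c a"
      by metis
    define H' where "H' a = H a \<oplus>\<^bsub>P\<^esub> monomial (t a) n" for a
    have H'P: "\<forall>a\<in>A. H' a \<in> carrier P"
      using HP t by (simp add: H'_def monomial_closed)
    have agree: "H a i = H' a i" if "a \<in> A" "i < n" for a i
      using that HP by (simp add: H'_def coeff_add monomial_def)
    have "S H' (N + n) = (\<Oplus>a\<in>A. (F a \<otimes>\<^bsub>P\<^esub> H a) (N + n) \<oplus> a \<otimes> c a)"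
      unfolding coeff_S[OF H'P]
    proof (rule finsum_cong')
      fix a assume a: "a \<in> A"
      have "F a \<otimes>\<^bsub>P\<^esub> H' a = F a \<otimes>\<^bsub>P\<^esub> H a \<oplus>\<^bsub>P\<^esub> F a \<otimes>\<^bsub>P\<^esub> monomial (t a) n"
        unfolding H'_def using a HP FP t by (intro P.distrib_left) (auto simp: monomial_closed)
      then show "(F a \<otimes>\<^bsub>P\<^esub> H' a) (N + n) = (F a \<otimes>\<^bsub>P\<^esub> H a) (N + n) \<oplus> a \<otimes> c a"
        using a FP t F(3) by (simp add: coeff_add coeff_mult_monomial)
    qed (use HP FP c AR in \<open>auto simp: P.mult_closed mult_closed Pi_iff\<close>)
    also have "\<dots> = S H (N + n) \<oplus> g (N + n)"
      unfolding c(2) coeff_S[OF HP]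
      using HP FP c AR by (intro finsum_addf) (auto simp: P.mult_closed mult_closed Pi_iff)
    also have "\<dots> = f (N + n)"
      using fP SP by (simp add: g a_lcomm r_neg)
    finally have "S H' (N + n) = f (N + n)" .
    moreover have "S H' k = f k" if "k < N + n" for k
      using S_cong[OF HP H'P agree that] Hf[OF that] by simp
    ultimately have "good (Suc n) H'"
      using H'P by (auto simp: good_def less_Suc_eq)
    then show "\<exists>H'. good (Suc n) H' \<and> (\<forall>a\<in>A. \<forall>i<n. H a i = H' a i)"
      using agree by blast
  qed
  then obtain H where good: "\<And>n. good n (H n)"
    and approx: "\<And>n a i. a \<in> A \<Longrightarrow> i < n \<Longrightarrow> H n a i = H (Suc n) a i"
    by blast
  have HP: "\<forall>a\<in>A. H n a \<in> carrier P" for n using good[of n] by (simp add: good_def)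
  \<comment> \<open>Coefficient \<open>i\<close> is frozen from stage \<open>Suc i\<close> on, so it
    can be read off there.\<close>
  define G where "G a i = H (Suc i) a i" for a i
  have GP: "\<forall>a\<in>A. G a \<in> carrier P"
    using HP by (simp add: mem_series_iff G_def)
  have GH: "H n a i = G a i" if "a \<in> A" "i < n" for a i n
  proof -
    from that(2) have "Suc i \<le> n" by simp
    then show ?thesis
    proof (induction n rule: dec_induct)
      case base
      show ?case by (simp add: G_def)
    next
      case (step n)
      then show ?case using approx[OF that(1), of i n] by simp
    qed
  qed
  have "f k = S G k" for k
  proof -
    have "S (H (Suc k)) k = S G k"
      by (rule S_cong[OF HP GP GH, of "Suc k"]) auto
    moreover have "S (H (Suc k)) k = f k" using good[of "Suc k"] by (simp add: good_def)
    ultimately show ?thesis by simp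
  qed
  then have "f = S G" by blast
  with GP show ?thesis unfolding S_def by blast
qed

section \<open>Stabilisation of ascending chains of right ideals of series\<close>

lemma right_noetherian_series:
  assumes noeth: "right_noetherian R" and qa: "right_quasi_associative R"
  shows "right_noetherian P"
proof (intro right_noetherian.intro right_noetherian_axioms.intro P.nonassoc_ring_axioms)
  fix J :: "nat \<Rightarrow> (nat \<Rightarrow> 'a) set"
  assume J: "\<And>n. right_ideal (J n) P" and asc: "\<And>n. J n \<subseteq> J (Suc n)"
  have mono: "J m \<subseteq> J n" if "m \<le> n" for m n
    by (rule lift_Suc_mono_le[of J, OF asc that])
  have mono_deg: "leading (J k) m \<subseteq> leading (J k) n" if "m \<le> n" for k m n
    by (rule lift_Suc_mono_le[of "leading (J k)", OF leading_Suc[OF J] that])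
  \<comment> \<open>Since the family increases in both the ideal and the degree, stability along the
    diagonal bounds it for all degrees from \<open>N\<close> on, uniformly in the ideal.\<close>
  have "\<exists>N. \<forall>n\<ge>N. leading (J n) n = leading (J N) N"
  proof (rule right_noetherian.right_acc[OF noeth])
    show "leading (J n) n \<subseteq> leading (J (Suc n)) (Suc n)" for n
      using leading_mono[OF mono[of n "Suc n"], of n] mono_deg[of n "Suc n" "Suc n"] by simp
  qed (rule right_ideal_leading[OF J])
  then obtain N where N: "\<And>n. n \<ge> N \<Longrightarrow> leading (J n) n = leading (J N) N" by blast
  obtain A where A: "finite A" "A \<subseteq> leading (J N) N" "leading (J N) N \<subseteq> right_span A"
    using noetherian_right_ideal_eq_right_span[OF noeth qa right_ideal_leading[OF J, of N N]]
    by blast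
  have "\<forall>a\<in>A. \<exists>f. f \<in> J N \<and> (\<forall>i<N. f i = \<zero>) \<and> f N = a"
    using A(2) by (auto simp: leading_def)
  then obtain F where F: "\<And>a. a \<in> A \<Longrightarrow> F a \<in> J N"
      "\<And>a i. a \<in> A \<Longrightarrow> i < N \<Longrightarrow> F a i = \<zero>" "\<And>a. a \<in> A \<Longrightarrow> F a N = a"
    by metis
  have "\<exists>M. \<forall>m\<ge>M. leading (J m) n = leading (J M) n" for n
    by (rule right_noetherian.right_acc[OF noeth])
      (rule right_ideal_leading[OF J], rule leading_mono[OF asc])
  then obtain M where M: "\<And>n m. m \<ge> M n \<Longrightarrow> leading (J m) n = leading (J (M n)) n" by metis
  \<comment> \<open>Only the finitely many degrees below \<open>N\<close> still need their own
    thresholds. Including \<open>N\<close> puts the lifts \<open>F a\<close> into \<open>J K\<close>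
    and keeps the set nonempty when \<open>N = 0\<close>.\<close>
  define K where "K = Max (insert N (M ` {..<N}))"
  have MK: "M n \<le> K" if "n < N" for n
    using that by (simp add: K_def)
  have NK: "N \<le> K" by (simp add: K_def)
  have "J m = J K" if m: "m \<ge> K" for m
  proof
    interpret Jm: right_ideal "J m" P by (rule J)
    interpret JK: right_ideal "J K" P by (rule J)
    \<comment> \<open>Such an \<open>f\<close> is a right combination of the \<open>F a\<close>.
      These already lie in \<open>J K\<close>, and the right factors are arbitrary series, so
      \<open>f\<close> lies in \<open>J K\<close> too.\<close>
    have high: "f \<in> J K" if f: "f \<in> J m" "\<And>i. i < N \<Longrightarrow> f i = \<zero>" for f
    proof -
      \<comment> \<open>Both indices are raised to \<open>max m n\<close>, which lands on the stable
        part of the diagonal.\<close>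
      have lead: "leading (J m) n \<subseteq> right_span A" if "n \<ge> N" for n
        using leading_mono[OF mono[of m "max m n"], of n] mono_deg[of n "max m n" "max m n"]
          N[of "max m n"] that A(3) by (simp add: le_max_iff_disj)
      have FJ: "F a \<in> J m" if "a \<in> A" for a
        using F(1)[OF that] mono[of N m] NK m by auto
      obtain H where H: "\<forall>a\<in>A. H a \<in> carrier P" "f = (\<Oplus>\<^bsub>P\<^esub>a\<in>A. F a \<otimes>\<^bsub>P\<^esub> H a)"
        using series_eq_finsum_mult[where F = F and N = N, OF J[of m] A(1) FJ F(2,3) lead f] by blast
      have "F a \<in> J K" if "a \<in> A" for a
        using F(1)[OF that] mono[OF NK] by auto
      then show ?thesis
        unfolding H(2) using H(1) A(1)
        by (intro JK.finsum_mem P.abelian_group_axioms) (auto intro: JK.right_mult_closed)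
    qed
    \<comment> \<open>Induction runs downwards from order \<open>N\<close>, settled by
      \<open>high\<close>, to order 0, where the vanishing condition is empty. Below
      \<open>N\<close>, subtracting an element of \<open>J K\<close> with the same leading
      coefficient raises the order.\<close>
    have "f \<in> J K" if "n \<le> N" "f \<in> J m" "\<And>i. i < n \<Longrightarrow> f i = \<zero>" for n f
      using that
    proof (induction n arbitrary: f rule: inc_induct)
      case base
      then show ?case by (rule high)
    next
      case (step n)
      have "f n \<in> leading (J m) n" using step.prems by (rule leadingI)
      also have "\<dots> = leading (J K) n"
        using M[of n m] M[of n K] MK[of n] step.hyps m by simp
      finally obtain g where g: "g \<in> J K" "\<And>i. i < n \<Longrightarrow> g i = \<zero>" "g n = f n"
        by (rule leadingE) blast
      have fP: "f \<in> carrier P" and gP: "g \<in> carrier P"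
        using step.prems(1) g(1) Jm.a_subset JK.a_subset by auto
      let ?h = "f \<oplus>\<^bsub>P\<^esub> \<ominus>\<^bsub>P\<^esub> g"
      have "?h \<in> J K"
      proof (rule step.IH)
        \<comment> \<open>The difference must stay in \<open>J m\<close> for the induction
          hypothesis to place it in \<open>J K\<close>; adding \<open>g\<close> back then recovers
          \<open>f\<close>.\<close>
        have "g \<in> J m" using g(1) mono[OF m] by blast
        then show "?h \<in> J m"
          by (intro Jm.a_closed step.prems Jm.a_inv_mem P.abelian_group_axioms)
        show "?h i = \<zero>" if "i < Suc n" for i
          using that step.prems(2) g fP gP
          by (auto simp: coeff_add coeff_a_inv less_Suc_eq r_neg)
      qed
      then have "?h \<oplus>\<^bsub>P\<^esub> g \<in> J K" using g(1) by (rule JK.a_closed)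
      moreover have "?h \<oplus>\<^bsub>P\<^esub> g = f" using fP gP by (simp add: P.a_assoc P.l_neg)
      ultimately show ?case by simp
    qed
    from this[of 0] show "J m \<subseteq> J K" by auto
    show "J K \<subseteq> J m" by (rule mono[OF m])
  qed
  then show "\<exists>N. \<forall>n\<ge>N. J n = J N" by blast
qed

end

theorem theorem3p12:
  fixes R :: "('a, 'm) ring_scheme" and \<sigma> :: "'a \<Rightarrow> 'a"
  assumes "unital_nonassoc_ring R"
    and "\<sigma> \<in> hom (add_monoid R) (add_monoid R)"
    and "\<sigma> \<one>\<^bsub>R\<^esub> = \<one>\<^bsub>R\<^esub>"
    and "right_noetherian R"
    and "right_quasi_associative R"
    and "\<sigma> ` carrier R = carrier R"
  shows "right_noetherian (skew_power_series R \<sigma>)"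
proof -
  interpret surjective_skew_series_ring R \<sigma>
    using assms by (intro surjective_skew_series_ring.intro skew_series_ring.intro
        skew_series_ring_axioms.intro surjective_skew_series_ring_axioms.intro)
  show ?thesis using assms by (intro right_noetherian_series)
qed

end
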